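(* Let $G$ be a finite simple graph that is $\{2K_2, K_5-e\}$-free with $\omega(G)\geq 4$. Then $\chi(G)\leq 6$ if $\omega(G)=4$, and $\chi(G)\leq \omega(G)$ if $\omega(G)\geq 5$.
   Context: $\chi(G)$ is the chromatic number and $\omega(G)$ the clique number of $G$. $2K_2$ is the disjoint union of two edges; $K_5-e$ is the complete graph on five vertices with one edge removed. A graph is $\mathcal{F}$-free if it has no induced subgraph isomorphic to a member of $\mathcal{F}$. *)

theory Defs
  imports Main
begin

record 'a graph =
  verts :: "'a set"
  edges :: "'a set set"

definition fin_simple_graph :: "'a graph \<Rightarrow> bool" where
  "fin_simple_graph G \<longleftrightarrow>
     finite (verts G) \<and> (\<forall>e \<in> edges G. e \<subseteq> verts G \<and> card e = 2)"

definition induced_subgraph :: "'a graph \<Rightarrow> 'a set \<Rightarrow> 'a graph" where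
  "induced_subgraph G W = \<lparr>verts = W, edges = {e \<in> edges G. e \<subseteq> W}\<rparr>"

definition graph_iso :: "'a graph \<Rightarrow> 'b graph \<Rightarrow> bool" where
  "graph_iso G H \<longleftrightarrow>
     (\<exists>f. bij_betw f (verts G) (verts H) \<and>
          (\<forall>x \<in> verts G. \<forall>y \<in> verts G. {x, y} \<in> edges G \<longleftrightarrow> {f x, f y} \<in> edges H))"

definition free_of :: "'b graph set \<Rightarrow> 'a graph \<Rightarrow> bool" where
  "free_of F G \<longleftrightarrow>
     \<not> (\<exists>H \<in> F. \<exists>W \<subseteq> verts G. graph_iso (induced_subgraph G W) H)"

definition clique :: "'a graph \<Rightarrow> 'a set \<Rightarrow> bool" where
  "clique G K \<longleftrightarrow>
     K \<subseteq> verts G \<and> (\<forall>x \<in> K. \<forall>y \<in> K. x \<noteq> y \<longrightarrow> {x, y} \<in> edges G)"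

definition clique_number :: "'a graph \<Rightarrow> nat" where
  "clique_number G = Max (card ` {K. clique G K})"

definition proper_colouring :: "'a graph \<Rightarrow> nat \<Rightarrow> ('a \<Rightarrow> nat) \<Rightarrow> bool" where
  "proper_colouring G k c \<longleftrightarrow>
     (\<forall>v \<in> verts G. c v < k) \<and>
     (\<forall>x \<in> verts G. \<forall>y \<in> verts G. {x, y} \<in> edges G \<longrightarrow> c x \<noteq> c y)"

definition chromatic_number :: "'a graph \<Rightarrow> nat" where
  "chromatic_number G = (LEAST k. \<exists>c. proper_colouring G k c)"

definition two_K2 :: "nat graph" where
  "two_K2 = \<lparr>verts = {0, 1, 2, 3}, edges = {{0, 1}, {2, 3}}\<rparr>"

definition complete_graph :: "nat \<Rightarrow> nat graph" where
  "complete_graph n = \<lparr>verts = {..<n}, edges = {e. e \<subseteq> {..<n} \<and> card e = 2}\<rparr>"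

definition K5_minus_e :: "nat graph" where
  "K5_minus_e = (complete_graph 5)\<lparr>edges := edges (complete_graph 5) - {{0, 1}}\<rparr>"

lemma fin_simple_graph_two_K2: "fin_simple_graph two_K2"
  by (auto simp: fin_simple_graph_def two_K2_def)

lemma fin_simple_graph_K5_minus_e: "fin_simple_graph K5_minus_e"
  by (auto simp: fin_simple_graph_def K5_minus_e_def complete_graph_def)

lemma finite_cliques:
  assumes "fin_simple_graph G"
  shows "finite {K. clique G K}"
  using assms
  by (auto simp: fin_simple_graph_def clique_def intro: finite_subset[of _ "Pow (verts G)"])

lemma clique_number_attained:
  assumes "fin_simple_graph G"
  shows "\<exists>K. clique G K \<and> card K = clique_number G"
proof -
  have "clique G {}" by (simp add: clique_def)
  then have "card ` {K. clique G K} \<noteq> {}" by blast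
  then have "clique_number G \<in> card ` {K. clique G K}"
    unfolding clique_number_def using finite_cliques[OF assms] by (intro Max_in) auto
  then show ?thesis by force
qed

lemma chromatic_number_attained:
  assumes "fin_simple_graph G"
  shows "\<exists>c. proper_colouring G (chromatic_number G) c"
proof -
  from assms have "finite (verts G)" by (simp add: fin_simple_graph_def)
  then obtain c where c: "bij_betw c (verts G) {0..<card (verts G)}"
    using ex_bij_betw_finite_nat by blast
  have "proper_colouring G (card (verts G)) c"
    unfolding proper_colouring_def
  proof (intro conjI ballI impI)
    fix v assume "v \<in> verts G"
    then show "c v < card (verts G)" using c by (auto simp: bij_betw_def)
  next
    fix x y assume xy: "x \<in> verts G" "y \<in> verts G" "{x, y} \<in> edges G"
    then have "card {x, y} = 2" using assms by (auto simp: fin_simple_graph_def)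
    then have "x \<noteq> y" by auto
    then show "c x \<noteq> c y" using c xy by (auto simp: bij_betw_def dest: inj_onD)
  qed
  then show ?thesis
    unfolding chromatic_number_def by (intro LeastI_ex[where P = "\<lambda>k. \<exists>c. proper_colouring G k c"]) blast
qed

end

theory Submission
  imports Defs
begin

text \<open>
  Fix a maximum clique \<open>K\<close> of size \<open>\<omega> \<ge> 4\<close> and label each vertex outside \<open>K\<close> by the set of its
  neighbours in \<open>K\<close>. Excluding \<open>K\<^sub>5 - e\<close> bounds every label by two elements, and excluding \<open>2K\<^sub>2\<close>
  forces the labels of two adjacent vertices outside \<open>K\<close> to cover all of \<open>K\<close> but at most one
  vertex. Hence it suffices to colour labels: each label avoids the colours of its own elements,
  and two labels that together miss at most one element of \<open>K\<close> receive different colours. For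
  \<open>\<omega> \<ge> 6\<close> no two labels conflict, for \<open>\<omega> = 5\<close> the conflicts are those of the Petersen graph, and
  for \<open>\<omega> = 4\<close> two colours not used on \<open>K\<close> suffice.
\<close>

lemma edge_distinct:
  assumes "fin_simple_graph G" and "{x, y} \<in> edges G"
  shows "x \<noteq> y"
  using assms by (force simp: fin_simple_graph_def)

lemma edge_in_verts:
  assumes "fin_simple_graph G" and "{x, y} \<in> edges G"
  shows "x \<in> verts G" "y \<in> verts G"
  using assms by (auto simp: fin_simple_graph_def)

lemma card_clique_le:
  assumes "fin_simple_graph G" and "clique G K"
  shows "card K \<le> clique_number G"
  unfolding clique_number_def using assms finite_cliques by (intro Max_ge) auto

lemma chromatic_number_le:
  assumes "proper_colouring G k c"
  shows "chromatic_number G \<le> k"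
  unfolding chromatic_number_def using assms by (intro Least_le) blast

text \<open>If no edge ran between the two given edges, their four endpoints would induce
  \<open>two_K2\<close>.\<close>

lemma two_K2_free_edges:
  assumes G: "fin_simple_graph G" and free: "free_of {two_K2, K5_minus_e} G"
    and ab: "{a, b} \<in> edges G" and cd: "{c, d} \<in> edges G"
    and disj: "{a, b} \<inter> {c, d} = {}"
  shows "\<exists>x\<in>{a, b}. \<exists>y\<in>{c, d}. {x, y} \<in> edges G"
proof (rule ccontr)
  assume "\<not> ?thesis"
  then have no: "{a, c} \<notin> edges G" "{a, d} \<notin> edges G" "{b, c} \<notin> edges G" "{b, d} \<notin> edges G"
    by auto
  have d: "a \<noteq> b" "c \<noteq> d" "a \<noteq> c" "a \<noteq> d" "b \<noteq> c" "b \<noteq> d"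
    using edge_distinct[OF G] ab cd disj by auto
  \<comment> \<open>\<open>graph_iso\<close> also compares each vertex with itself, so the
    degenerate pairs \<open>{x, x}\<close> must be known to be non-edges.\<close>
  have loop: "{x} \<notin> edges G" for x
    using G by (force simp: fin_simple_graph_def)
  define f where "f = (\<lambda>z. if z = a then 0 else if z = b then 1 else if z = c then 2 else 3 :: nat)"
  have f: "f a = 0" "f b = 1" "f c = 2" "f d = 3"
    using d by (auto simp: f_def)
  have "graph_iso (induced_subgraph G {a, b, c, d}) two_K2"
    unfolding graph_iso_def
    using ab cd no d loop
    by (intro exI[of _ f])
      (auto simp: induced_subgraph_def two_K2_def f bij_betw_def doubleton_eq_iff insert_commute)
  moreover have "{a, b, c, d} \<subseteq> verts G"
    using edge_in_verts[OF G] ab cd by auto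
  ultimately show False
    using free unfolding free_of_def by blast
qed

lemma K5_minus_e_edge_iff:
  "{i, j} \<in> edges K5_minus_e \<longleftrightarrow> i \<noteq> j \<and> i < 5 \<and> j < 5 \<and> {i, j} \<noteq> {0, 1}"
  by (auto simp: K5_minus_e_def complete_graph_def card_insert_if)

text \<open>Otherwise the triangle together with \<open>x\<close> and \<open>y\<close> would induce
  \<open>K5_minus_e\<close>, with \<open>{x, y}\<close> as the missing edge.\<close>

lemma K5_minus_e_free_common_triangle:
  assumes G: "fin_simple_graph G" and free: "free_of {two_K2, K5_minus_e} G"
    and T: "clique G {p, q, r}" "p \<noteq> q" "p \<noteq> r" "q \<noteq> r"
    and x: "{x, p} \<in> edges G" "{x, q} \<in> edges G" "{x, r} \<in> edges G"
    and y: "{y, p} \<in> edges G" "{y, q} \<in> edges G" "{y, r} \<in> edges G"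
    and "x \<noteq> y"
  shows "{x, y} \<in> edges G"
proof (rule ccontr)
  assume no: "{x, y} \<notin> edges G"
  have t: "{p, q} \<in> edges G" "{p, r} \<in> edges G" "{q, r} \<in> edges G"
    using T by (auto simp: clique_def)
  have d: "x \<noteq> p" "x \<noteq> q" "x \<noteq> r" "y \<noteq> p" "y \<noteq> q" "y \<noteq> r"
    using edge_distinct[OF G] x y by auto
  have loop: "{z} \<notin> edges G" for z
    using G by (force simp: fin_simple_graph_def)
  \<comment> \<open>The two non-adjacent vertices go to 0 and 1, the ends of the edge removed from
    the complete graph.\<close>
  define f where "f = (\<lambda>z. if z = x then 0 else if z = y then 1 else if z = p then 2
    else if z = q then 3 else 4 :: nat)"
  have f: "f x = 0" "f y = 1" "f p = 2" "f q = 3" "f r = 4"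
    using d T \<open>x \<noteq> y\<close> by (auto simp: f_def)
  have five: "verts K5_minus_e = {0, 1, 2, 3, 4}"
    by (auto simp: K5_minus_e_def complete_graph_def)
  have "graph_iso (induced_subgraph G {x, y, p, q, r}) K5_minus_e"
    unfolding graph_iso_def
  proof (intro exI[of _ f] conjI)
    show "bij_betw f (verts (induced_subgraph G {x, y, p, q, r})) (verts K5_minus_e)"
      using d T(2-) \<open>x \<noteq> y\<close> by (simp add: bij_betw_def induced_subgraph_def f five)
    show "\<forall>u\<in>verts (induced_subgraph G {x, y, p, q, r}).
      \<forall>v\<in>verts (induced_subgraph G {x, y, p, q, r}).
        {u, v} \<in> edges (induced_subgraph G {x, y, p, q, r}) \<longleftrightarrow> {f u, f v} \<in> edges K5_minus_e"
      unfolding K5_minus_e_edge_iff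
      using x y t no loop
      by (simp add: induced_subgraph_def f doubleton_eq_iff insert_commute)
  qed
  moreover have "{x, y, p, q, r} \<subseteq> verts G"
    using edge_in_verts[OF G] x y by auto
  ultimately show False
    using free unfolding free_of_def by blast
qed

text \<open>Three neighbours of \<open>x\<close> in \<open>K\<close> form a triangle. Any vertex of
  \<open>K\<close> not adjacent to \<open>x\<close> is joined to that triangle as well, so it would
  have to be adjacent to \<open>x\<close> after all.\<close>

lemma card_neighbours_in_maximum_clique_le:
  assumes G: "fin_simple_graph G" and free: "free_of {two_K2, K5_minus_e} G"
    and K: "clique G K" "card K = clique_number G"
    and x: "x \<in> verts G" "x \<notin> K"
  shows "card {v \<in> K. {x, v} \<in> edges G} \<le> 2"
proof (rule ccontr)
  assume "\<not> ?thesis"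
  then have "3 \<le> card {v \<in> K. {x, v} \<in> edges G}" by simp
  then obtain T where T: "T \<subseteq> {v \<in> K. {x, v} \<in> edges G}" "card T = 3"
    by (meson obtain_subset_with_card_n)
  then obtain p q r where pqr: "T = {p, q, r}" "p \<noteq> q" "p \<noteq> r" "q \<noteq> r"
    by (auto simp: card_3_iff)
  have finK: "finite K"
    using G K by (auto simp: fin_simple_graph_def clique_def intro: finite_subset)
  \<comment> \<open>Maximality of \<open>K\<close> supplies the vertex \<open>v\<close> of
    \<open>K\<close> missed by \<open>x\<close>; it differs from \<open>p\<close>, \<open>q\<close>,
    \<open>r\<close> because these are neighbours of \<open>x\<close>.\<close>
  have "\<not> clique G (insert x K)"
    using card_clique_le[OF G, of "insert x K"] K x finK by auto
  then obtain v where v: "v \<in> K" "{x, v} \<notin> edges G"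
    using K x by (auto simp: clique_def insert_commute)
  have "{v, p} \<in> edges G" "{v, q} \<in> edges G" "{v, r} \<in> edges G"
    using K T pqr v by (auto simp: clique_def)
  moreover have "clique G {p, q, r}"
    using K T pqr by (auto simp: clique_def)
  ultimately have "{x, v} \<in> edges G"
    using K5_minus_e_free_common_triangle[OF G free, of p q r x v] T pqr v x by auto
  with v show False by simp
qed

text \<open>Two vertices of \<open>K\<close> missed by both \<open>x\<close> and \<open>y\<close>
  would span an edge that has no connection to \<open>{x, y}\<close>.\<close>

lemma clique_almost_covered_by_edge:
  assumes G: "fin_simple_graph G" and free: "free_of {two_K2, K5_minus_e} G"
    and K: "clique G K" and xy: "{x, y} \<in> edges G" "x \<notin> K" "y \<notin> K"
  shows "card K \<le> Suc (card {v \<in> K. {x, v} \<in> edges G \<or> {y, v} \<in> edges G})"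
proof -
  let ?N = "{v \<in> K. {x, v} \<in> edges G \<or> {y, v} \<in> edges G}"
  have finK: "finite K"
    using G K by (auto simp: fin_simple_graph_def clique_def intro: finite_subset)
  have "u = v" if "u \<in> K - ?N" "v \<in> K - ?N" for u v
  proof (rule ccontr)
    assume "u \<noteq> v"
    then have "{u, v} \<in> edges G" using that K by (auto simp: clique_def)
    then show False
      using two_K2_free_edges[OF G free xy(1), of u v] that xy by auto
  qed
  then have "card (K - ?N) \<le> Suc 0"
    using finK by (subst card_le_Suc0_iff_eq) auto
  moreover have "card (K - ?N) = card K - card ?N"
    using finK by (intro card_Diff_subset) auto
  ultimately show ?thesis by linarith
qed

text \<open>A bijection from a maximum clique to \<open>{..<clique_number G}\<close> serves both as
  the colouring of the clique and as the naming of label elements. An element of a label is then the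
  colour of a neighbour, so \<open>range\<close> settles the edges between the clique and the rest,
  and \<open>conflict\<close> settles the edges outside the clique.\<close>

lemma chromatic_number_le_label_colouring:
  fixes \<phi> :: "nat set \<Rightarrow> nat"
  assumes G: "fin_simple_graph G" and free: "free_of {two_K2, K5_minus_e} G"
    and k: "clique_number G \<le> k"
    and range: "\<And>S. \<lbrakk>S \<subseteq> {..<clique_number G}; card S \<le> 2\<rbrakk> \<Longrightarrow> \<phi> S < k \<and> \<phi> S \<notin> S"
    and conflict: "\<And>S T. \<lbrakk>S \<subseteq> {..<clique_number G}; T \<subseteq> {..<clique_number G};
        card S \<le> 2; card T \<le> 2; clique_number G \<le> Suc (card (S \<union> T))\<rbrakk> \<Longrightarrow> \<phi> S \<noteq> \<phi> T"
  shows "chromatic_number G \<le> k"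
proof -
  obtain K where K: "clique G K" "card K = clique_number G"
    using clique_number_attained[OF G] by blast
  have finK: "finite K"
    using G K by (auto simp: fin_simple_graph_def clique_def intro: finite_subset)
  obtain f where f: "bij_betw f K {..<clique_number G}"
    using finK K ex_bij_betw_finite_nat by (metis atLeast0LessThan)
  then have inj: "inj_on f K" by (simp add: bij_betw_def)
  define N where "N x = {v \<in> K. {x, v} \<in> edges G}" for x
  define c where "c x = (if x \<in> K then f x else \<phi> (f ` N x))" for x
  have sub: "f ` N x \<subseteq> {..<clique_number G}" for x
    using f by (auto simp: N_def bij_betw_def)
  have card_image_N: "card (f ` A) = card A" if "A \<subseteq> K" for A
    using inj that by (meson card_image inj_on_subset)
  have small: "card (f ` N x) \<le> 2" if "x \<in> verts G" "x \<notin> K" for x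
    using card_neighbours_in_maximum_clique_le[OF G free K that] card_image_N[of "N x"]
    by (auto simp: N_def)
  have cross: "c x \<noteq> c y" if "x \<in> K" "y \<in> verts G" "y \<notin> K" "{x, y} \<in> edges G" for x y
  proof -
    have "f x \<in> f ` N y" using that by (auto simp: N_def insert_commute)
    then show ?thesis
      using range[OF sub small[OF that(2,3)]] that by (simp add: c_def) metis
  qed
  have "proper_colouring G k c"
    unfolding proper_colouring_def
  proof (intro conjI ballI impI)
    fix v assume "v \<in> verts G"
    moreover have "f v < k" if "v \<in> K"
      using bij_betwE[OF f] that k by force
    ultimately show "c v < k"
      using range[OF sub small] by (simp add: c_def)
  next
    fix x y assume xy: "x \<in> verts G" "y \<in> verts G" "{x, y} \<in> edges G"
    consider "x \<in> K" "y \<in> K" | "x \<in> K" "y \<notin> K" | "x \<notin> K" "y \<in> K" | "x \<notin> K" "y \<notin> K"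
      by blast
    then show "c x \<noteq> c y"
    proof cases
      case 1
      then show ?thesis
        using inj edge_distinct[OF G xy(3)] by (auto simp: c_def dest: inj_onD)
    next
      case 2
      then show ?thesis using cross xy by blast
    next
      case 3
      then show ?thesis using cross[of y x] xy by (metis insert_commute)
    next
      case 4
      have "N x \<union> N y = {v \<in> K. {x, v} \<in> edges G \<or> {y, v} \<in> edges G}"
        by (auto simp: N_def)
      then have "clique_number G \<le> Suc (card (N x \<union> N y))"
        using clique_almost_covered_by_edge[OF G free K(1) xy(3) 4] K by simp
      also have "card (N x \<union> N y) = card (f ` N x \<union> f ` N y)"
        using card_image_N[of "N x \<union> N y"] by (auto simp: N_def image_Un)
      finally show ?thesis
        using conflict[OF sub sub small small] xy 4 by (auto simp: c_def)
    qed
  qed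
  then show ?thesis by (rule chromatic_number_le)
qed

text \<open>Any two distinct pairs from four elements conflict, so the six pairs get six different
  colours. Smaller labels join a pair that contains them, hence labels of equal colour have a union
  of at most two elements. The pairs \<open>{0, 1}\<close> and \<open>{2, 3}\<close> take the
  colours 4 and 5, which the clique does not use.\<close>

definition label_colour4 :: "nat set \<Rightarrow> nat" where
  "label_colour4 S =
     (if 0 \<in> S \<and> 1 \<in> S then 4 else if 2 \<in> S \<and> 3 \<in> S then 5
      else if 0 \<in> S then (if 3 \<in> S then 2 else 1) else (if 3 \<in> S then 0 else 3))"

text \<open>Only disjoint pairs conflict here. Colour 3 goes to the subsets of
  \<open>{0, 1, 2}\<close>, where any two pairs meet, and colour 4 to the remaining labels without
  4, which all contain 3. The pairs through 4 meet each other but involve every element, so they are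
  split between the colours 0 and 2 to keep each colour out of its own label.\<close>

definition label_colour5 :: "nat set \<Rightarrow> nat" where
  "label_colour5 S =
     (if 4 \<in> S then (if 2 \<in> S \<or> 3 \<in> S then 0 else 2) else (if 3 \<in> S then 4 else 3))"

text \<open>The labels are presented as subsets of an explicit list so that evaluation can go
  through the finitely many cases.\<close>

lemma label_colour4_range:
  "\<forall>S\<in>Pow (set [0, 1, 2, 3]). card S \<le> 2 \<longrightarrow> label_colour4 S < 6 \<and> label_colour4 S \<notin> S"
  by code_simp

lemma label_colour4_conflict:
  "\<forall>S\<in>Pow (set [0, 1, 2, 3]). card S \<le> 2 \<longrightarrow> (\<forall>T\<in>Pow (set [0, 1, 2, 3]). card T \<le> 2 \<longrightarrow>
     4 \<le> Suc (card (S \<union> T)) \<longrightarrow> label_colour4 S \<noteq> label_colour4 T)"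
  by code_simp

lemma label_colour5_range:
  "\<forall>S\<in>Pow (set [0, 1, 2, 3, 4]). card S \<le> 2 \<longrightarrow> label_colour5 S < 5 \<and> label_colour5 S \<notin> S"
  by code_simp

lemma label_colour5_conflict:
  "\<forall>S\<in>Pow (set [0, 1, 2, 3, 4]). card S \<le> 2 \<longrightarrow> (\<forall>T\<in>Pow (set [0, 1, 2, 3, 4]). card T \<le> 2 \<longrightarrow>
     5 \<le> Suc (card (S \<union> T)) \<longrightarrow> label_colour5 S \<noteq> label_colour5 T)"
  by code_simp

theorem theorem2p8:
  fixes G :: "'a graph"
  assumes "fin_simple_graph G"
    and "free_of {two_K2, K5_minus_e} G"
    and "clique_number G \<ge> 4"
  shows "(clique_number G = 4 \<longrightarrow> chromatic_number G \<le> 6) \<and>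
         (clique_number G \<ge> 5 \<longrightarrow> chromatic_number G \<le> clique_number G)"
proof -
  have four: "{..<4} = set [0, 1, 2, 3 :: nat]" and five: "{..<5} = set [0, 1, 2, 3, 4 :: nat]"
    by auto
  consider "clique_number G = 4" | "clique_number G = 5" | "clique_number G \<ge> 6"
    using assms(3) by linarith
  then show ?thesis
  proof cases
    case 1
    have "chromatic_number G \<le> 6"
      using label_colour4_range label_colour4_conflict
      by (intro chromatic_number_le_label_colouring[OF assms(1,2), where \<phi> = label_colour4])
        (simp_all add: 1 four del: set_simps)
    with 1 show ?thesis by simp
  next
    case 2
    have "chromatic_number G \<le> 5"
      using label_colour5_range label_colour5_conflict
      by (intro chromatic_number_le_label_colouring[OF assms(1,2), where \<phi> = label_colour5])
        (simp_all add: 2 five del: set_simps)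
    with 2 show ?thesis by simp
  next
    case 3
    have "chromatic_number G \<le> clique_number G"
    \<comment> \<open>Two labels cover at most four of the at least six clique vertices and so miss
      two or more. No conflict can arise, and any colour outside the label will do.\<close>
    proof (rule chromatic_number_le_label_colouring[OF assms(1,2), where \<phi> = "\<lambda>S. LEAST i. i \<notin> S"])
      fix S assume S: "S \<subseteq> {..<clique_number G}" "card S \<le> 2"
      \<comment> \<open>By size, some colour below \<open>clique_number G\<close> lies outside
        \<open>S\<close>, and it bounds the least one.\<close>
      have "S \<noteq> {..<clique_number G}" using S 3 by auto
      then obtain i where "i < clique_number G" "i \<notin> S" using S by blast
      then show "(LEAST i. i \<notin> S) < clique_number G \<and> (LEAST i. i \<notin> S) \<notin> S"
        by (metis (mono_tags, lifting) LeastI Least_le le_less_trans)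
    next
      fix S T :: "nat set"
      assume "card S \<le> 2" "card T \<le> 2" "clique_number G \<le> Suc (card (S \<union> T))"
      then show "(LEAST i. i \<notin> S) \<noteq> (LEAST i. i \<notin> T)"
        using 3 card_Un_le[of S T] by linarith
    qed simp
    with 3 show ?thesis by simp
  qed
qed

end
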